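(* Let $|N|=4$ and $|O|=3$. Then the following holds for the random deferred acceptance mechanism RDA. (a) RDA is at-most-$q$-agent-object-wasteful for some $q<\frac{1}{6}$. (b) RDA is at-most-$q$-object-wasteful for some $q\geq\frac{1}{4}$.
   Context: Model. $N=\{1,\ldots,n\}$ is a finite set of agents and $O$ a finite set of objects. Each agent $i$ has a strict preference $R_i$, a linear order over $O\cup\{i\}$, where $i$ stands for being unassigned; $P_i$ is its asymmetric part, and $o\in O$ is acceptable to $i$ if $oP_ii$. $\mathcal{R}^N$ is the set of all profiles $R=(R_i)_{i\in N}$ of such linear orders. An assignment is a map $\mu$ on $N$ with $\mu_i\in O\cup\{i\}$ for all $i$ and $\mu_i\neq\mu_j$ for $i\neq j$; $\mathcal{M}$ is the set of assignments and $\Delta(\mathcal{M})$ the set of probability distributions over it. A mechanism is a map $f:\mathcal{R}^N\to\Delta(\mathcal{M})$; $f_{ia}(R)$ is the probability that $i$ is assigned $a\in O\cup\{i\}$ under $f(R)$, and $f_{oo}(R)=1-\sum_{j\in N}f_{jo}(R)$ for $o\in O$. RDA. A priority structure $\gtrsim=(\gtrsim_o)_{o\in O}$ specifies a strict priority order $\gtrsim_o$ over $N$ for each object $o$. $DA^{\gtrsim}(R)$ is the outcome of the agent-proposing deferred acceptance algorithm: in step 1 each agent proposes to his top-ranked acceptable object (and is unassigned if there is none); each object tentatively accepts the highest $\gtrsim_o$-ranked proposer and rejects the others. In each later step, each agent rejected in the previous step proposes to his top-ranked acceptable object among those that have not yet rejected him (and is unassigned if there is none); each object tentatively accepts the highest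 $\gtrsim_o$-ranked agent among its tentatively accepted agent and its new proposers, rejecting the others. The algorithm stops when there is no rejection, and tentative acceptances become final. RDA selects for each $R$ the outcome $DA^{\gtrsim}(R)$ with $\gtrsim$ drawn uniformly at random, i.e. each priority structure $\gtrsim$ has probability $\left(\frac{1}{|N|!}\right)^{|O|}$ (probabilities of identical outcomes are added). Waste. For $q\in[0,1]$, $f$ is $q$-agent-object-wasteful if there exist a profile $R$, $o\in O$ and $i\in N$ with $oP_ii$ and $\min\{f_{ii}(R),f_{oo}(R)\}\ge q$. $f$ is $q$-object-wasteful if there exist a profile $R$ and $o\in O$ with $\min\{\sum_{i\in N:\,oP_ii}f_{ii}(R),\,f_{oo}(R)\}\ge q$. $f$ is at-most-$q$-agent-object-wasteful (resp. at-most-$q$-object-wasteful) if $f$ is $q$-agent-object-wasteful (resp. $q$-object-wasteful) and not $q'$-agent-object-wasteful (resp. $q'$-object-wasteful) for any $q'>q$. *)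

theory Defs
  imports "HOL-Probability.Probability_Mass_Function" "HOL-Library.While_Combinator"
begin

text \<open>
  Agents are the elements of a finite type \<open>'n\<close>, objects those of a finite type \<open>'o\<close>.
  The set \<open>O \<union> {i}\<close> of possible outcomes of agent \<open>i\<close> is rendered as \<open>'o option\<close>:
  \<open>Some o\<close> is the object \<open>o\<close>, and \<open>None\<close> is \<open>i\<close> itself (being unassigned).
  For linear orders, \<open>(x, y) \<in> r\<close> reads "\<open>x\<close> ranks at least as high as \<open>y\<close>", both for
  preferences and for priorities.
\<close>

type_synonym ('n, 'o) profile = "'n \<Rightarrow> 'o option rel"
type_synonym ('n, 'o) assignment = "'n \<Rightarrow> 'o option"
type_synonym ('n, 'o) priority = "'o \<Rightarrow> 'n rel"
type_synonym ('n, 'o) mechanism = "('n, 'o) profile \<Rightarrow> ('n, 'o) assignment pmf"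

definition profiles :: "('n, 'o) profile set" where
  "profiles = {R. \<forall>i. linear_order (R i)}"

definition assignments :: "('n, 'o) assignment set" where
  "assignments = {\<mu>. \<forall>i j. i \<noteq> j \<longrightarrow> \<mu> i = \<mu> j \<longrightarrow> \<mu> i = None}"

text \<open>Outside \<open>profiles\<close> the values of a mechanism are irrelevant.\<close>

definition is_mechanism :: "('n, 'o) mechanism \<Rightarrow> bool" where
  "is_mechanism f \<longleftrightarrow> (\<forall>R\<in>profiles. set_pmf (f R) \<subseteq> assignments)"

text \<open>As \<open>Some x \<noteq> None\<close>, weak and strict preference over being unassigned coincide.\<close>

definition acceptable :: "'o option rel \<Rightarrow> 'o \<Rightarrow> bool" where
  "acceptable r x \<longleftrightarrow> (Some x, None) \<in> r"

definition priorities :: "('n, 'o) priority set" where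
  "priorities = {p. \<forall>x. linear_order (p x)}"


subsection \<open>Deferred acceptance\<close>

text \<open>
  \<open>tentative\<close>: the tentative acceptances, seen from the agents;
  \<open>rejecters i\<close>: the objects that have rejected \<open>i\<close> so far;
  \<open>proposers\<close>: the agents whose turn it is to propose, i.e. everybody in the first step and
  the agents rejected in the previous step afterwards.
\<close>

record ('n, 'o) da_state =
  tentative :: "('n, 'o) assignment"
  rejecters :: "'n \<Rightarrow> 'o set"
  proposers :: "'n set"

definition top_acceptable :: "'o option rel \<Rightarrow> 'o set \<Rightarrow> 'o option" where
  "top_acceptable r A =
    (if \<exists>x\<in>A. acceptable r x
     then Some (THE x. x \<in> A \<and> acceptable r x \<and>
                  (\<forall>y\<in>A. acceptable r y \<longrightarrow> (Some x, Some y) \<in> r))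
     else None)"

text \<open>The object that currently considers agent \<open>i\<close>, either because \<open>i\<close> now proposes to it or
  because it has tentatively accepted \<open>i\<close> before.\<close>

definition da_bid :: "('n, 'o) profile \<Rightarrow> ('n, 'o) da_state \<Rightarrow> 'n \<Rightarrow> 'o option" where
  "da_bid R s i =
    (if i \<in> proposers s then top_acceptable (R i) (- rejecters s i) else tentative s i)"

definition da_rejected ::
    "('n, 'o) priority \<Rightarrow> ('n, 'o) profile \<Rightarrow> ('n, 'o) da_state \<Rightarrow> 'o \<Rightarrow> 'n set" where
  "da_rejected p R s x =
    {i. da_bid R s i = Some x \<and> \<not> (\<forall>j. da_bid R s j = Some x \<longrightarrow> (i, j) \<in> p x)}"

definition da_step ::
    "('n, 'o) priority \<Rightarrow> ('n, 'o) profile \<Rightarrow> ('n, 'o) da_state \<Rightarrow> ('n, 'o) da_state" where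
  "da_step p R s =
    \<lparr> tentative = (\<lambda>i. if \<exists>x. i \<in> da_rejected p R s x then None else da_bid R s i),
      rejecters = (\<lambda>i. rejecters s i \<union> {x. i \<in> da_rejected p R s x}),
      proposers = {i. \<exists>x. i \<in> da_rejected p R s x} \<rparr>"

definition da_init :: "('n, 'o) da_state" where
  "da_init = \<lparr> tentative = (\<lambda>_. None), rejecters = (\<lambda>_. {}), proposers = UNIV \<rparr>"

definition DA :: "('n, 'o) priority \<Rightarrow> ('n, 'o) profile \<Rightarrow> ('n, 'o) assignment" where
  "DA p R = tentative (while (\<lambda>s. proposers s \<noteq> {}) (da_step p R) da_init)"

definition RDA :: "('n::finite, 'o::finite) mechanism" where
  "RDA R = map_pmf (\<lambda>p. DA p R) (pmf_of_set priorities)"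


subsection \<open>Waste\<close>

definition assign_prob :: "('n::finite, 'o) mechanism \<Rightarrow> ('n, 'o) profile \<Rightarrow> 'n \<Rightarrow> 'o option \<Rightarrow> real" where
  "assign_prob f R i a = measure_pmf.prob (f R) {\<mu>. \<mu> i = a}"

definition unassigned_prob :: "('n::finite, 'o) mechanism \<Rightarrow> ('n, 'o) profile \<Rightarrow> 'o \<Rightarrow> real" where
  "unassigned_prob f R x = 1 - (\<Sum>j\<in>UNIV. assign_prob f R j (Some x))"

definition agent_object_wasteful :: "real \<Rightarrow> ('n::finite, 'o) mechanism \<Rightarrow> bool" where
  "agent_object_wasteful q f \<longleftrightarrow>
    (\<exists>R\<in>profiles. \<exists>x i. acceptable (R i) x \<and>
       min (assign_prob f R i None) (unassigned_prob f R x) \<ge> q)"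

definition object_wasteful :: "real \<Rightarrow> ('n::finite, 'o) mechanism \<Rightarrow> bool" where
  "object_wasteful q f \<longleftrightarrow>
    (\<exists>R\<in>profiles. \<exists>x.
       min (\<Sum>i | acceptable (R i) x. assign_prob f R i None) (unassigned_prob f R x) \<ge> q)"

definition at_most_agent_object_wasteful :: "real \<Rightarrow> ('n::finite, 'o) mechanism \<Rightarrow> bool" where
  "at_most_agent_object_wasteful q f \<longleftrightarrow>
    q \<in> {0..1} \<and> agent_object_wasteful q f \<and> (\<forall>q'\<in>{q<..1}. \<not> agent_object_wasteful q' f)"

definition at_most_object_wasteful :: "real \<Rightarrow> ('n::finite, 'o) mechanism \<Rightarrow> bool" where
  "at_most_object_wasteful q f \<longleftrightarrow>
    q \<in> {0..1} \<and> object_wasteful q f \<and> (\<forall>q'\<in>{q<..1}. \<not> object_wasteful q' f)"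


subsection \<open>RDA is a mechanism\<close>

text \<open>In particular the iteration in \<open>DA\<close> terminates, and \<open>pmf_of_set\<close> in \<open>RDA\<close> is applied to a
  finite nonempty set, so that it is the uniform distribution.\<close>

lemma top_acceptable_in:
  fixes r :: "'o::finite option rel"
  assumes "linear_order r" "top_acceptable r A = Some x"
  shows "x \<in> A \<and> acceptable r x"
proof -
  let ?B = "{x \<in> A. acceptable r x}"
  have ne: "?B \<noteq> {}" using assms(2) by (auto simp: top_acceptable_def split: if_splits)
  have r: "refl r" "antisym r" "trans r" "total r"
    using assms(1) by (auto simp: order_on_defs)
  have "\<exists>x\<in>B. \<forall>y\<in>B. (Some x, Some y) \<in> r" if "finite B" "B \<noteq> {}" for B
    using that
  proof (induction B rule: finite_ne_induct)
    case (singleton x)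
    then show ?case using r(1) by (auto simp: refl_on_def)
  next
    case (insert a F)
    then obtain x where x: "x \<in> F" "\<forall>y\<in>F. (Some x, Some y) \<in> r" by blast
    have "(Some x, Some a) \<in> r \<or> (Some a, Some x) \<in> r"
      using r(1,4) by (metis UNIV_I refl_onD total_on_def)
    then show ?case
    proof
      assume "(Some x, Some a) \<in> r"
      then show ?thesis using x by blast
    next
      assume "(Some a, Some x) \<in> r"
      then have "\<forall>y\<in>F. (Some a, Some y) \<in> r" using x r(3) by (meson transD)
      moreover have "(Some a, Some a) \<in> r" using r(1) by (simp add: refl_on_def)
      ultimately show ?thesis by blast
    qed
  qed
  from this[OF _ ne] obtain z where z: "z \<in> ?B" "\<forall>y\<in>?B. (Some z, Some y) \<in> r" by auto
  have "(THE x. x \<in> A \<and> acceptable r x \<and> (\<forall>y\<in>A. acceptable r y \<longrightarrow> (Some x, Some y) \<in> r)) = z"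
  proof (rule the_equality)
    show "z \<in> A \<and> acceptable r z \<and> (\<forall>y\<in>A. acceptable r y \<longrightarrow> (Some z, Some y) \<in> r)"
      using z by blast
  next
    fix w assume "w \<in> A \<and> acceptable r w \<and> (\<forall>y\<in>A. acceptable r y \<longrightarrow> (Some w, Some y) \<in> r)"
    then have "(Some w, Some z) \<in> r" "(Some z, Some w) \<in> r" using z by auto
    then show "w = z" using r(2) by (auto dest: antisymD)
  qed
  then show ?thesis using assms(2) z by (auto simp: top_acceptable_def split: if_splits)
qed

definition da_measure :: "('n::finite, 'o::finite) da_state \<Rightarrow> nat" where
  "da_measure s = card {(i, x). x \<notin> rejecters s i} + (if proposers s = {} then 0 else 1)"

definition da_inv :: "('n, 'o) da_state \<Rightarrow> bool" where
  "da_inv s \<longleftrightarrow> tentative s \<in> assignments \<and> (\<forall>i x. tentative s i = Some x \<longrightarrow> x \<notin> rejecters s i)"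

lemma da_bid_not_rejecter:
  fixes s :: "('n, 'o::finite) da_state"
  assumes "R \<in> profiles" "da_inv s" "da_bid R s i = Some x"
  shows "x \<notin> rejecters s i"
  using assms top_acceptable_in[of "R i" "- rejecters s i" x]
  by (auto simp: da_bid_def da_inv_def profiles_def split: if_splits)

lemma da_inv_step:
  fixes s :: "('n, 'o::finite) da_state"
  assumes "R \<in> profiles" "p \<in> priorities" "da_inv s"
  shows "da_inv (da_step p R s)"
proof -
  have "i = j" if "da_bid R s i = Some x" "da_bid R s j = Some x"
    "i \<notin> da_rejected p R s x" "j \<notin> da_rejected p R s x" for i j x
  proof -
    have "(i, j) \<in> p x" "(j, i) \<in> p x" using that by (auto simp: da_rejected_def)
    moreover have "antisym (p x)" using assms(2) by (auto simp: priorities_def order_on_defs)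
    ultimately show ?thesis by (auto dest: antisymD)
  qed
  then have "tentative (da_step p R s) \<in> assignments"
    unfolding assignments_def da_step_def
    by simp (metis not_None_eq)
  then show ?thesis
    using da_bid_not_rejecter[OF assms(1,3)]
    by (auto simp: da_inv_def da_step_def split: if_splits)
qed

lemma da_measure_step:
  fixes s :: "('n::finite, 'o::finite) da_state"
  assumes "R \<in> profiles" "da_inv s" "proposers s \<noteq> {}"
  shows "da_measure (da_step p R s) < da_measure s"
proof (cases "\<exists>i x. i \<in> da_rejected p R s x")
  case True
  then obtain i x where ix: "i \<in> da_rejected p R s x" by blast
  then have "x \<notin> rejecters s i"
    using da_bid_not_rejecter[OF assms(1,2)] by (auto simp: da_rejected_def)
  then have "{(i, x). x \<notin> rejecters (da_step p R s) i} \<subset> {(i, x). x \<notin> rejecters s i}"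
    using ix by (auto simp: da_step_def)
  then have "card {(i, x). x \<notin> rejecters (da_step p R s) i} < card {(i, x). x \<notin> rejecters s i}"
    by (intro psubset_card_mono) auto
  then show ?thesis using assms(3) by (simp add: da_measure_def)
next
  case False
  then have "rejecters (da_step p R s) = rejecters s" "proposers (da_step p R s) = {}"
    by (auto simp: da_step_def)
  then show ?thesis using assms(3) by (simp add: da_measure_def)
qed

lemma DA_terminates:
  fixes p :: "('n::finite, 'o::finite) priority"
  assumes "R \<in> profiles" "p \<in> priorities"
  shows "\<exists>s. while_option (\<lambda>s. proposers s \<noteq> {}) (da_step p R) da_init = Some s"
proof (rule measure_while_option_Some[where P = da_inv and f = da_measure])
  show "da_inv (da_init :: ('n, 'o) da_state)"
    by (simp add: da_inv_def da_init_def assignments_def)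
next
  fix s :: "('n, 'o) da_state"
  assume "da_inv s" "proposers s \<noteq> {}"
  then show "da_inv (da_step p R s) \<and> da_measure (da_step p R s) < da_measure s"
    using assms da_inv_step da_measure_step by blast
qed

lemma DA_assignment:
  fixes p :: "('n::finite, 'o::finite) priority"
  assumes "R \<in> profiles" "p \<in> priorities"
  shows "DA p R \<in> assignments"
proof -
  obtain s where s: "while_option (\<lambda>s. proposers s \<noteq> {}) (da_step p R) da_init = Some s"
    using DA_terminates[OF assms] by blast
  have "da_inv s"
  proof (rule while_option_rule[OF _ s])
    show "da_inv (da_init :: ('n, 'o) da_state)"
      by (simp add: da_inv_def da_init_def assignments_def)
  qed (use da_inv_step[OF assms] in blast)
  then show ?thesis using s by (simp add: DA_def while_def da_inv_def)
qed

lemma priorities_nonempty: "(priorities :: ('n, 'o) priority set) \<noteq> {}"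
proof -
  obtain r :: "'n rel" where "well_order r" using well_order_on[of "UNIV :: 'n set"] by blast
  then have "(\<lambda>_. r) \<in> priorities" by (simp add: priorities_def well_order_on_def)
  then show ?thesis by blast
qed

lemma RDA_mechanism: "is_mechanism (RDA :: ('n::finite, 'o::finite) mechanism)"
  by (auto simp: is_mechanism_def RDA_def DA_assignment priorities_nonempty)

end

theory Submission
  imports Defs "HOL-Combinatorics.Transposition"
begin

text \<open>
  Only the stability of deferred acceptance is used. Suppose that \<open>i\<close> finds \<open>z\<close> acceptable, and that
  both the event "\<open>i\<close> is unassigned" and the event "\<open>z\<close> is unassigned" have positive probability.
  The first event needs another agent \<open>j\<close> who accepts \<open>z\<close>. In the second event everybody who
  accepts \<open>z\<close> gets something better among the other two objects, so that only \<open>i\<close> and \<open>j\<close> accept \<open>z\<close>,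
  and for suitable names \<open>i\<close> prefers \<open>x\<close> to \<open>z\<close> and \<open>j\<close> prefers \<open>y\<close> to \<open>z\<close>. If \<open>i\<close> is unassigned, then
  \<open>j\<close> holds \<open>z\<close> and beats \<open>i\<close> there, and the remaining agents \<open>k\<close>, \<open>l\<close> hold \<open>x\<close>, \<open>y\<close> in one of the two
  possible ways, the holder of \<open>x\<close> beating \<open>i\<close> and the holder of \<open>y\<close> beating \<open>j\<close>. Each way has
  probability at most \<open>1/8\<close>, so one may assume that \<open>k\<close> and \<open>l\<close> accept both objects. If \<open>i\<close> accepts \<open>y\<close>
  or \<open>j\<close> prefers \<open>x\<close> to \<open>z\<close>, a further comparison is forced and each way has probability at most
  \<open>1/12\<close>; as the two overlap, the total is below \<open>1/6\<close>. Otherwise \<open>z\<close> can only be unassigned if \<open>i\<close>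
  beats \<open>k\<close>, \<open>l\<close> at \<open>x\<close> and \<open>j\<close> beats them at \<open>y\<close>, which has probability \<open>1/9\<close>.

  For object waste, let the acceptable objects be \<open>x\<close> then \<open>z\<close> for \<open>i\<close>, \<open>y\<close> then \<open>z\<close> for \<open>j\<close>, only \<open>x\<close>
  for \<open>k\<close> and only \<open>y\<close> for \<open>l\<close>. Then \<open>i\<close> and \<open>j\<close> are each unassigned with probability \<open>1/8\<close>, and \<open>z\<close> is
  unassigned with probability \<open>1/4\<close>.
\<close>

section \<open>Stability of deferred acceptance\<close>

lemma linear_order_finite_maximum:
  assumes "linear_order r" "finite B" "B \<noteq> {}"
  shows "\<exists>x\<in>B. \<forall>y\<in>B. (x, y) \<in> r"
  using assms(2,3)
proof (induction B rule: finite_ne_induct)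
  case (singleton x)
  then show ?case using assms(1) by (auto simp: order_on_defs refl_on_def)
next
  case (insert a F)
  then obtain x where x: "x \<in> F" "\<forall>y\<in>F. (x, y) \<in> r" by blast
  have r: "refl r" "trans r" "total r" using assms(1) by (auto simp: order_on_defs)
  have "(x, a) \<in> r \<or> (a, x) \<in> r" using r by (metis UNIV_I refl_onD total_on_def)
  then show ?case
  proof
    assume "(a, x) \<in> r"
    then have "\<forall>y\<in>insert a F. (a, y) \<in> r" using x r by (metis UNIV_I insertE refl_onD transD)
    then show ?thesis by blast
  qed (use x in blast)
qed

lemma top_acceptable_best:
  fixes r :: "'o::finite option rel"
  assumes "linear_order r" "x \<in> A" "acceptable r x"
  shows "(top_acceptable r A, Some x) \<in> r"
proof -
  let ?B = "Some ` {x \<in> A. acceptable r x}"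
  obtain z where z: "z \<in> A" "acceptable r z" "\<forall>y\<in>A. acceptable r y \<longrightarrow> (Some z, Some y) \<in> r"
    using linear_order_finite_maximum[OF assms(1), of ?B] assms(2,3) by auto
  have "antisym r" using assms(1) by (simp add: order_on_defs)
  then have "top_acceptable r A = Some z"
    using z by (auto simp: top_acceptable_def dest: antisymD intro!: the_equality)
  then show ?thesis using z(3) assms(2,3) by simp
qed

text \<open>Rejections are justified by the current holders, and an agent who is not proposing holds
  the best acceptable object left to him, if any. Once nobody proposes, this is stability.\<close>

definition stable_inv :: "('n, 'o) priority \<Rightarrow> ('n, 'o) profile \<Rightarrow> ('n, 'o) da_state \<Rightarrow> bool" where
  "stable_inv p R s \<longleftrightarrow>
     (\<forall>i. tentative s i =
        (if i \<in> proposers s then None else top_acceptable (R i) (- rejecters s i))) \<and>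
     (\<forall>i x. x \<in> rejecters s i \<longrightarrow> (\<exists>j. j \<noteq> i \<and> tentative s j = Some x \<and> (j, i) \<in> p x))"

text \<open>Objects only trade up: a previous holder bids again, so the highest-ranked bidder still
  ranks above everybody the object has rejected before.\<close>

lemma stable_inv_step:
  fixes s :: "('n::finite, 'o) da_state"
  assumes p: "p \<in> priorities" and inv: "stable_inv p R s"
  shows "stable_inv p R (da_step p R s)"
proof -
  let ?t = "da_step p R s"
  have p': "trans (p x)" "antisym (p x)" "linear_order (p x)" for x
    using p by (auto simp: priorities_def order_on_defs)
  have bid: "da_bid R s i = top_acceptable (R i) (- rejecters s i)" for i
    using inv by (auto simp: stable_inv_def da_bid_def)
  have 1: "tentative ?t i =
      (if i \<in> proposers ?t then None else top_acceptable (R i) (- rejecters ?t i))" for i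
    using bid by (auto simp: da_step_def)
  have best: "\<exists>j. tentative ?t j = Some x \<and> (\<forall>h. da_bid R s h = Some x \<longrightarrow> (j, h) \<in> p x)"
    if "da_bid R s i = Some x" for i x
  proof -
    obtain j where j: "da_bid R s j = Some x" "\<forall>h. da_bid R s h = Some x \<longrightarrow> (j, h) \<in> p x"
      using linear_order_finite_maximum[OF p'(3), of "{h. da_bid R s h = Some x}"] \<open>da_bid R s i = Some x\<close>
      by auto
    then have "\<forall>y. j \<notin> da_rejected p R s y" by (auto simp: da_rejected_def)
    then show ?thesis using j by (auto simp: da_step_def)
  qed
  have "\<exists>j. j \<noteq> i \<and> tentative ?t j = Some x \<and> (j, i) \<in> p x" if "x \<in> rejecters ?t i" for i x
  proof (cases "x \<in> rejecters s i")
    case True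
    then obtain h where h: "h \<noteq> i" "tentative s h = Some x" "(h, i) \<in> p x"
      using inv unfolding stable_inv_def by blast
    then have "da_bid R s h = Some x"
      using inv by (auto simp: stable_inv_def da_bid_def split: if_splits)
    from best[OF this] this obtain j where j: "tentative ?t j = Some x" "(j, h) \<in> p x" by blast
    then have "(j, i) \<in> p x" "j \<noteq> i" using h p' by (meson transD, metis antisymD)
    then show ?thesis using j by blast
  next
    case False
    then have i: "i \<in> da_rejected p R s x" using that by (auto simp: da_step_def)
    then have "da_bid R s i = Some x" by (simp add: da_rejected_def)
    from best[OF this] this obtain j where j: "tentative ?t j = Some x" "(j, i) \<in> p x" by blast
    then have "j \<noteq> i" using i by (auto simp: da_step_def split: if_splits)
    then show ?thesis using j by blast
  qed
  then show ?thesis using 1 by (auto simp: stable_inv_def)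
qed

lemma DA_stable_inv:
  fixes p :: "('n::finite, 'o::finite) priority"
  assumes "R \<in> profiles" "p \<in> priorities"
  obtains s where "stable_inv p R s" "proposers s = {}" "DA p R = tentative s"
proof -
  obtain s where s: "while_option (\<lambda>s. proposers s \<noteq> {}) (da_step p R) da_init = Some s"
    using DA_terminates[OF assms] by blast
  have "stable_inv p R s"
  proof (rule while_option_rule[OF _ s])
    show "stable_inv p R da_init" by (simp add: stable_inv_def da_init_def)
  qed (use stable_inv_step[OF assms(2)] in blast)
  moreover have "proposers s = {}" using while_option_stop[OF s] by simp
  moreover have "DA p R = tentative s" using s by (simp add: DA_def while_def)
  ultimately show ?thesis using that by blast
qed

lemma DA_individually_rational:
  fixes p :: "('n::finite, 'o::finite) priority"
  assumes "R \<in> profiles" "p \<in> priorities" "DA p R i = Some x"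
  shows "acceptable (R i) x"
proof -
  obtain s where "stable_inv p R s" "proposers s = {}" "DA p R = tentative s"
    using DA_stable_inv[OF assms(1,2)] .
  then have "top_acceptable (R i) (- rejecters s i) = Some x"
    using assms(3) by (simp add: stable_inv_def)
  then show ?thesis using top_acceptable_in assms(1) by (auto simp: profiles_def)
qed

text \<open>If \<open>x\<close> has not rejected \<open>i\<close> at the end, then \<open>i\<close>
  holds something at least as good; otherwise the final holder of \<open>x\<close> outranks
  \<open>i\<close> there.\<close>

lemma DA_no_blocking_pair:
  fixes p :: "('n::finite, 'o::finite) priority"
  assumes "R \<in> profiles" "p \<in> priorities" "acceptable (R i) x"
  shows "(DA p R i, Some x) \<in> R i \<or> (\<exists>j. j \<noteq> i \<and> DA p R j = Some x \<and> (j, i) \<in> p x)"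
proof -
  obtain s where "stable_inv p R s" "proposers s = {}" "DA p R = tentative s"
    using DA_stable_inv[OF assms(1,2)] .
  moreover have "linear_order (R i)" using assms(1) by (simp add: profiles_def)
  ultimately show ?thesis
    using top_acceptable_best[of "R i" x "- rejecters s i"] assms(3)
    unfolding stable_inv_def by (metis ComplI empty_iff)
qed

lemma DA_inj:
  fixes p :: "('n::finite, 'o::finite) priority"
  assumes "R \<in> profiles" "p \<in> priorities" "DA p R i = Some x" "DA p R j = Some x"
  shows "i = j"
  using DA_assignment[OF assms(1,2)] assms(3,4) unfolding assignments_def by force

section \<open>Consequences of stability for unassigned agents and objects\<close>

lemma linear_order_antisym:
  assumes "linear_order r" "(a, b) \<in> r" "(b, a) \<in> r"
  shows "a = b"
  using assms by (auto simp: order_on_defs dest: antisymD)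

lemma DA_unassigned_envy:
  fixes p :: "('n::finite, 'o::finite) priority"
  assumes "R \<in> profiles" "p \<in> priorities" "acceptable (R i) x" "DA p R i = None"
  shows "\<exists>j. j \<noteq> i \<and> DA p R j = Some x \<and> (j, i) \<in> p x"
proof -
  have "(None, Some x) \<notin> R i"
    using assms(1,3) linear_order_antisym[of "R i"] by (auto simp: profiles_def acceptable_def)
  then show ?thesis using DA_no_blocking_pair[OF assms(1-3)] assms(4) by auto
qed

text \<open>A free object has no holder who could outrank \<open>i\<close>, so \<open>i\<close> gets
  something at least as good, and not \<open>x\<close> itself.\<close>

lemma DA_free_object_preferred:
  fixes p :: "('n::finite, 'o::finite) priority"
  assumes "R \<in> profiles" "p \<in> priorities" "acceptable (R i) x" and free: "\<And>j. DA p R j \<noteq> Some x"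
  shows "\<exists>y. y \<noteq> x \<and> DA p R i = Some y \<and> acceptable (R i) y \<and> (Some y, Some x) \<in> R i"
proof -
  have "(DA p R i, Some x) \<in> R i" using DA_no_blocking_pair[OF assms(1-3)] free by blast
  moreover have "DA p R i \<noteq> None" using DA_unassigned_envy[OF assms(1-3)] free by blast
  ultimately show ?thesis
    using free[of i] DA_individually_rational[OF assms(1,2), of i] by (cases "DA p R i") auto
qed

lemma acceptable_trans:
  assumes "linear_order r" "(Some x, Some y) \<in> r" "acceptable r y"
  shows "acceptable r x"
  using assms unfolding acceptable_def order_on_defs by (meson transD)


section \<open>Uniform strict orders\<close>

abbreviation uniform_order :: "'a::finite rel pmf" where
  "uniform_order \<equiv> pmf_of_set {r. linear_order r}"

lemma linear_orders_nonempty: "{r :: 'a rel. linear_order r} \<noteq> {}"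
  using well_order_on[of "UNIV :: 'a set"] by (auto simp: well_order_on_def)

lemma linear_order_of_rank:
  fixes f :: "'a \<Rightarrow> nat"
  assumes "inj f"
  shows "linear_order {(a, b). f a \<le> f b}"
  using assms
  by (auto simp: order_on_defs refl_on_def trans_def antisym_def total_on_def inj_eq)

lemma linear_order_inv_image:
  assumes "linear_order r" "inj f"
  shows "linear_order (inv_image r f)"
proof -
  have r: "refl r" "trans r" "antisym r" "total r" using assms(1) by (auto simp: order_on_defs)
  have "refl (inv_image r f)" using r(1) by (simp add: refl_on_def)
  moreover have "trans (inv_image r f)" using r(2) by (rule trans_inv_image)
  moreover have "antisym (inv_image r f)"
    using r(3) assms(2) by (auto intro!: antisymI dest: antisymD injD)
  moreover have "total (inv_image r f)" using r(4) assms(2) by (simp add: total_on_def inj_eq)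
  ultimately show ?thesis by (simp add: order_on_defs)
qed

text \<open>Relabelling by the transposition of \<open>h\<close> and \<open>k\<close> is an
  involution on orders that preserves \<open>S\<close> and exchanges the two candidates for the
  top.\<close>

lemma card_top_le:
  fixes S :: "'a::finite set"
  assumes "h \<in> S" "k \<in> S"
  shows "card {r. linear_order r \<and> (\<forall>j\<in>S. (h, j) \<in> r)} \<le>
         card {r. linear_order r \<and> (\<forall>j\<in>S. (k, j) \<in> r)}"
proof (rule card_inj_on_le)
  let ?t = "Transposition.transpose h k"
  let ?g = "\<lambda>r :: 'a rel. inv_image r ?t"
  have "?g (?g r) = r" for r by (simp add: inv_image_def)
  then show "inj_on ?g {r. linear_order r \<and> (\<forall>j\<in>S. (h, j) \<in> r)}" by (rule inj_on_inverseI)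
  have "?t j \<in> S" if "j \<in> S" for j using that assms by (auto simp: Transposition.transpose_def)
  then show "?g ` {r. linear_order r \<and> (\<forall>j\<in>S. (h, j) \<in> r)} \<subseteq>
      {r. linear_order r \<and> (\<forall>j\<in>S. (k, j) \<in> r)}"
    by (auto intro!: linear_order_inv_image)
qed simp

text \<open>The orders split according to the maximum of \<open>insert k S\<close>, and by symmetry
  all classes have the same size.\<close>

lemma prob_top:
  fixes S :: "'a::finite set"
  assumes "k \<notin> S"
  shows "measure_pmf.prob uniform_order {r. \<forall>j\<in>S. (k, j) \<in> r} = 1 / (card S + 1)"
proof -
  let ?L = "{r :: 'a rel. linear_order r}"
  let ?T = "\<lambda>h. {r :: 'a rel. linear_order r \<and> (\<forall>j\<in>insert k S. (h, j) \<in> r)}"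
  have "?L = (\<Union>h\<in>insert k S. ?T h)"
    using linear_order_finite_maximum[of _ "insert k S"] by auto
  then have "card ?L = card (\<Union>h\<in>insert k S. ?T h)" by simp
  also have "\<dots> = (\<Sum>h\<in>insert k S. card (?T h))"
    by (rule card_UN_disjoint) (auto dest: linear_order_antisym)
  also have "\<dots> = (\<Sum>h\<in>insert k S. card (?T k))"
    by (intro sum.cong refl le_antisym card_top_le) simp_all
  finally have *: "card ?L = (card S + 1) * card (?T k)"
    using assms by (simp only: sum_constant) simp
  have "card ?L \<noteq> 0" using linear_orders_nonempty[where 'a='a] by simp
  then have pos: "card (?T k) \<noteq> 0" unfolding * by (metis mult_0_right)
  have "?L \<inter> {r. \<forall>j\<in>S. (k, j) \<in> r} = ?T k" by (auto simp: order_on_defs refl_on_def)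
  then have "measure_pmf.prob uniform_order {r. \<forall>j\<in>S. (k, j) \<in> r} = card (?T k) / card ?L"
    by (simp only: measure_pmf_of_set[OF linear_orders_nonempty finite])
  also have "\<dots> = 1 / real (card S + 1)"
    unfolding * of_nat_mult using pos
    by (simp only: of_nat_eq_0_iff nonzero_divide_mult_cancel_right not_False_eq_True)
  finally show ?thesis .
qed

section \<open>Independence of the priority orders at the three objects\<close>

abbreviation uniform_priority :: "('n::finite, 'o::finite) priority pmf" where
  "uniform_priority \<equiv> pmf_of_set priorities"

text \<open>\<open>priorities\<close> is a product of three copies of the set of linear orders, so
  the uniform distribution makes the three orders independent.\<close>

lemma prob_three_objects:
  fixes x y z :: "'o::finite" and P Q T :: "'n::finite rel \<Rightarrow> bool"
  assumes "UNIV = {x, y, z}" "x \<noteq> y" "x \<noteq> z" "y \<noteq> z"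
  shows "measure_pmf.prob uniform_priority {p. P (p x) \<and> Q (p y) \<and> T (p z)} =
    measure_pmf.prob uniform_order {r. P r} *
    measure_pmf.prob uniform_order {r. Q r} *
    measure_pmf.prob uniform_order {r. T r}"
proof -
  let ?L = "{r :: 'n rel. linear_order r}"
  let ?S = "(\<lambda>_. ?L)(x := ?L \<inter> {r. P r}, y := ?L \<inter> {r. Q r}, z := ?L \<inter> {r. T r})"
  have card_PiE_UNIV: "card (PiE UNIV F) = card (F x) * card (F y) * card (F z)"
    for F :: "'o \<Rightarrow> 'n rel set"
    using assms(2-4) by (subst card_PiE) (simp_all add: assms(1))
  have eq: "(priorities :: ('n, 'o) priority set) = PiE UNIV (\<lambda>_. ?L)"
    by (auto simp: priorities_def)
  have 1: "card (priorities :: ('n, 'o) priority set) = card ?L * card ?L * card ?L"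
    unfolding eq by (rule card_PiE_UNIV)
  have "priorities \<inter> {p. P (p x) \<and> Q (p y) \<and> T (p z)} = PiE UNIV ?S"
    using assms(2-4) by (auto simp: priorities_def PiE_def Pi_def split: if_splits)
  then have 2: "card (priorities \<inter> {p. P (p x) \<and> Q (p y) \<and> T (p z)}) =
      card (?L \<inter> {r. P r}) * card (?L \<inter> {r. Q r}) * card (?L \<inter> {r. T r})"
    using assms(2-4) by (simp add: card_PiE_UNIV)
  show ?thesis
    using linear_orders_nonempty[where 'a='n] priorities_nonempty[where 'n='n and 'o='o]
    by (simp add: measure_pmf_of_set 1 2)
qed

lemma prob_pos_order:
  fixes r :: "'a::finite rel"
  assumes "linear_order r" "P r"
  shows "measure_pmf.prob uniform_order {r. P r} > 0"
proof -
  have "{r. linear_order r} \<inter> {r. P r} \<noteq> {}" using assms by blast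
  then show ?thesis
    using linear_orders_nonempty[where 'a='a]
    by (simp add: measure_pmf_of_set card_gt_0_iff del: Int_Collect)
qed

text \<open>Only the support \<open>priorities\<close> matters, which is where the stability results
  apply.\<close>

lemma prob_mono_priority:
  assumes "\<And>p. p \<in> priorities \<Longrightarrow> p \<in> A \<Longrightarrow> p \<in> B"
  shows "measure_pmf.prob (uniform_priority :: ('n::finite, 'o::finite) priority pmf) A \<le>
         measure_pmf.prob uniform_priority B"
  using assms priorities_nonempty[where 'n='n and 'o='o]
  by (intro measure_pmf.finite_measure_mono_AE) (auto simp: AE_measure_pmf_iff)

lemma prob_pos_priority:
  assumes "measure_pmf.prob (uniform_priority :: ('n::finite, 'o::finite) priority pmf) A > 0"
  obtains p where "p \<in> priorities" "p \<in> A"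
proof -
  have "priorities \<inter> A \<noteq> {}"
    using assms priorities_nonempty[where 'n='n and 'o='o] by (auto simp: measure_pmf_of_set)
  then show ?thesis using that by blast
qed


section \<open>Assignment probabilities\<close>

lemma assign_prob_RDA:
  "assign_prob RDA R i a = measure_pmf.prob uniform_priority {p. DA p R i = a}"
  by (simp add: assign_prob_def RDA_def vimage_def)

lemma unassigned_prob_RDA:
  fixes R :: "('n::finite, 'o::finite) profile"
  assumes "R \<in> profiles"
  shows "unassigned_prob RDA R x = measure_pmf.prob uniform_priority {p. \<forall>j. DA p R j \<noteq> Some x}"
proof -
  let ?M = "measure_pmf (uniform_priority :: ('n, 'o) priority pmf)"
  \<comment> \<open>Restriction to \<open>priorities\<close> makes these events disjoint, since an
    assignment gives an object to at most one agent.\<close>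
  let ?E = "\<lambda>j. {p \<in> priorities. DA p R j = Some x}"
  have "(\<Sum>j\<in>UNIV. assign_prob RDA R j (Some x)) = (\<Sum>j\<in>UNIV. measure ?M (?E j))"
    unfolding assign_prob_RDA
    by (intro sum.cong refl antisym prob_mono_priority) auto
  also have "\<dots> = measure ?M (\<Union>j. ?E j)"
    using DA_inj[OF assms]
    by (intro measure_pmf.finite_measure_finite_Union[symmetric]) (auto simp: disjoint_family_on_def)
  also have "1 - \<dots> = measure ?M (UNIV - (\<Union>j. ?E j))"
    using measure_pmf.prob_compl[of "\<Union>j. ?E j" uniform_priority] by simp
  also have "\<dots> = measure ?M {p. \<forall>j. DA p R j \<noteq> Some x}"
    by (intro antisym prob_mono_priority) auto
  finally show ?thesis by (simp add: unassigned_prob_def)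
qed


text \<open>Turns comparisons into numbers by independence and \<open>prob_top\<close>. An empty set
  contributes the factor 1 and leaves its object unconstrained.\<close>

lemma prob_tops:
  fixes x y z :: "'o::finite" and a b c :: "'n::finite"
  assumes "UNIV = {x, y, z}" "x \<noteq> y" "x \<noteq> z" "y \<noteq> z"
    and "a \<notin> A" "b \<notin> B" "c \<notin> C"
  shows "measure_pmf.prob uniform_priority
      {p. (\<forall>h\<in>A. (a, h) \<in> p x) \<and> (\<forall>h\<in>B. (b, h) \<in> p y) \<and> (\<forall>h\<in>C. (c, h) \<in> p z)} =
    1 / real ((card A + 1) * (card B + 1) * (card C + 1))"
  using prob_three_objects[OF assms(1-4), of "\<lambda>r. \<forall>h\<in>A. (a, h) \<in> r"
      "\<lambda>r. \<forall>h\<in>B. (b, h) \<in> r" "\<lambda>r. \<forall>h\<in>C. (c, h) \<in> r"]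
  unfolding prob_top[OF assms(5)] prob_top[OF assms(6)] prob_top[OF assms(7)]
  by (simp only: of_nat_mult times_divide_times_eq mult_1_left)

text \<open>Serves both as a priority order witnessing a positive probability and as a preference.
  Rank 3 is a default, intended for \<open>d\<close> as the last remaining element.\<close>

definition order4 :: "'a \<Rightarrow> 'a \<Rightarrow> 'a \<Rightarrow> 'a \<Rightarrow> 'a rel" where
  "order4 a b c d =
    (let f = (\<lambda>u. if u = a then 0 else if u = b then 1 else if u = c then 2 else 3 :: nat)
     in {(u, v). f u \<le> f v})"

lemma linear_order4:
  assumes "UNIV = {a, b, c, d}"
  shows "linear_order (order4 a b c d)"
proof -
  have cases: "u = a \<or> u = b \<or> u = c \<or> u = d" for u using assms by blast
  let ?f = "\<lambda>u. if u = a then 0 else if u = b then 1 else if u = c then 2 else 3 :: nat"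
  have "inj ?f"
  proof (rule injI)
    fix u v assume "?f u = ?f v"
    then show "u = v" using cases[of u] cases[of v] by (auto split: if_splits)
  qed
  from linear_order_of_rank[OF this] show ?thesis by (simp only: order4_def Let_def)
qed

text \<open>Each of the two events has probability \<open>1/12\<close>, and they overlap.\<close>

lemma prob_union_lt:
  fixes x y z :: "'o::finite" and i j k l :: "'n::finite"
  assumes "UNIV = {x, y, z}" "x \<noteq> y" "x \<noteq> z" "y \<noteq> z"
    and agents: "UNIV = {i, j, k, l}" "distinct [i, j, k, l]"
    and AB: "A \<subseteq> {i, j}" "B \<subseteq> {i, j}" "(card A + 1) * (card B + 1) = 6"
  shows "measure_pmf.prob uniform_priority
     ({p. (\<forall>h\<in>A. (k, h) \<in> p x) \<and> (\<forall>h\<in>B. (l, h) \<in> p y) \<and> (\<forall>h\<in>{i}. (j, h) \<in> p z)} \<union>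
      {p. (\<forall>h\<in>A. (l, h) \<in> p x) \<and> (\<forall>h\<in>B. (k, h) \<in> p y) \<and> (\<forall>h\<in>{i}. (j, h) \<in> p z)}) < 1 / 6"
    (is "measure_pmf.prob _ (?F \<union> ?G) < _")
proof -
  have notin: "k \<notin> A" "l \<notin> A" "k \<notin> B" "l \<notin> B" "j \<notin> {i}" using AB agents(2) by auto
  have F: "measure_pmf.prob uniform_priority ?F = 1 / 12"
    and G: "measure_pmf.prob uniform_priority ?G = 1 / 12"
    by (simp_all only: prob_tops[OF assms(1-4)] notin AB(3) not_False_eq_True) simp_all
  let ?P = "\<lambda>D r. (\<forall>h\<in>D. (k, h) \<in> r) \<and> (\<forall>h\<in>D. (l, h) \<in> r)"
  \<comment> \<open>A single order can serve at all three objects: \<open>k\<close> and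
    \<open>l\<close> above \<open>i\<close> and \<open>j\<close>, and \<open>j\<close> above
    \<open>i\<close>. So both events can occur together.\<close>
  have "UNIV = {k, l, j, i}" using agents(1) by auto
  then have lin: "linear_order (order4 k l j i)" by (rule linear_order4)
  have rank: "?P D (order4 k l j i)" "\<forall>h\<in>{i}. (j, h) \<in> order4 k l j i" if "D \<subseteq> {i, j}" for D
    using that agents(2) by (auto simp: order4_def)
  have "?F \<inter> ?G = {p. ?P A (p x) \<and> ?P B (p y) \<and> (\<forall>h\<in>{i}. (j, h) \<in> p z)}" by blast
  then have "measure_pmf.prob uniform_priority (?F \<inter> ?G) =
      measure_pmf.prob uniform_order {r. ?P A r} * measure_pmf.prob uniform_order {r. ?P B r} *
      measure_pmf.prob uniform_order {r. \<forall>h\<in>{i}. (j, h) \<in> r}"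
    using prob_three_objects[OF assms(1-4), of "?P A" "?P B" "\<lambda>r. \<forall>h\<in>{i}. (j, h) \<in> r"]
    by (simp only:)
  also have "\<dots> > 0"
    using rank AB(1,2) by (intro mult_pos_pos prob_pos_order[OF lin]) auto
  finally have "measure_pmf.prob uniform_priority (?F \<inter> ?G) > 0" .
  moreover have "measure_pmf.prob uniform_priority (?F \<union> ?G) =
      measure_pmf.prob uniform_priority ?F + measure_pmf.prob uniform_priority ?G
      - measure_pmf.prob uniform_priority (?G \<inter> ?F)"
    by (simp add: measure_pmf.finite_measure_Union' measure_pmf.finite_measure_Diff')
  ultimately show ?thesis unfolding F G by (simp add: Int_commute)
qed


section \<open>Agent-object waste\<close>

text \<open>Only \<open>j\<close> can keep \<open>i\<close> from \<open>z\<close>. As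
  \<open>i\<close> lacks \<open>x\<close> and \<open>j\<close> lacks \<open>y\<close>, stability
  puts these objects with the other two agents, named \<open>k'\<close> and \<open>l'\<close>
  accordingly. The implications at the end supply the comparison that lowers 1/8 to 1/12.\<close>

lemma DA_unassigned_priorities:
  fixes p :: "('n::finite, 'o::finite) priority"
  assumes R: "R \<in> profiles" and p: "p \<in> priorities"
    and agents: "UNIV = {i, j, k, l}"
    and objects: "x \<noteq> y" "x \<noteq> z" "y \<noteq> z"
    and z: "acceptable (R i) z" "acceptable (R j) z" "\<not> acceptable (R k) z" "\<not> acceptable (R l) z"
    and pref: "(Some x, Some z) \<in> R i" "(Some y, Some z) \<in> R j"
    and i: "DA p R i = None"
  shows "(j, i) \<in> p z \<and> (\<exists>k' l'. (k' = k \<and> l' = l \<or> k' = l \<and> l' = k) \<and>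
    acceptable (R k') x \<and> acceptable (R l') y \<and> (k', i) \<in> p x \<and> (l', j) \<in> p y \<and>
    (acceptable (R i) y \<longrightarrow> (l', i) \<in> p y) \<and> ((Some x, Some z) \<in> R j \<longrightarrow> (k', j) \<in> p x))"
proof -
  note rational = DA_individually_rational[OF R p]
  note inj = DA_inj[OF R p]
  have lin: "linear_order (R h)" for h using R by (simp add: profiles_def)
  have "acceptable (R i) x" using acceptable_trans[OF lin pref(1) z(1)] .
  have agents_cases: "h = i \<or> h = j \<or> h = k \<or> h = l" for h using agents by blast
  obtain h where h: "h \<noteq> i" "DA p R h = Some z" "(h, i) \<in> p z"
    using DA_unassigned_envy[OF R p z(1) i] by blast
  then have "h = j" using rational[of h z] z agents_cases[of h] by auto
  then have j: "DA p R j = Some z" "(j, i) \<in> p z" using h by auto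
  have better: "\<exists>h. DA p R h = Some w \<and> (h, j) \<in> p w" if "(Some w, Some z) \<in> R j" "w \<noteq> z" for w
  proof -
    have "(Some z, Some w) \<notin> R j" using linear_order_antisym[OF lin that(1)] that(2) by blast
    moreover have "acceptable (R j) w" using acceptable_trans[OF lin that(1) z(2)] .
    ultimately show ?thesis using DA_no_blocking_pair[OF R p, of j w] j(1) by auto
  qed
  obtain k' where k': "DA p R k' = Some x" "(k', i) \<in> p x"
    using DA_unassigned_envy[OF R p \<open>acceptable (R i) x\<close> i] by blast
  obtain l' where l': "DA p R l' = Some y" "(l', j) \<in> p y"
    using better[OF pref(2)] objects by blast
  have "k' \<noteq> i" "k' \<noteq> j" "l' \<noteq> i" "l' \<noteq> j" "k' \<noteq> l'" using k' l' i j objects by auto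
  then have "k' = k \<and> l' = l \<or> k' = l \<and> l' = k"
    using agents_cases[of k'] agents_cases[of l'] by auto
  moreover have "(l', i) \<in> p y" if "acceptable (R i) y"
    using DA_unassigned_envy[OF R p that i] inj l'(1) by blast
  moreover have "(k', j) \<in> p x" if "(Some x, Some z) \<in> R j"
    using better[OF that] objects inj k'(1) by blast
  ultimately show ?thesis
    using j(2) k' l' rational[OF k'(1)] rational[OF l'(1)] by blast
qed

text \<open>When \<open>z\<close> is free, \<open>i\<close> can only hold \<open>x\<close> and
  \<open>j\<close> can only hold \<open>y\<close>, so \<open>h\<close> is unassigned and must be
  outranked at both.\<close>

lemma DA_free_object_priorities:
  fixes p :: "('n::finite, 'o::finite) priority"
  assumes R: "R \<in> profiles" and p: "p \<in> priorities"
    and objects: "UNIV = {x, y, z}"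
    and z: "acceptable (R i) z" "acceptable (R j) z"
    and ij: "\<not> acceptable (R i) y" "(Some x, Some z) \<notin> R j"
    and free: "\<And>h. DA p R h \<noteq> Some z"
    and h: "h \<noteq> i" "h \<noteq> j" "acceptable (R h) x" "acceptable (R h) y"
  shows "(i, h) \<in> p x \<and> (j, h) \<in> p y"
proof -
  note rational = DA_individually_rational[OF R p]
  have objects_cases: "w = x \<or> w = y \<or> w = z" for w using objects by blast
  note good = DA_free_object_preferred[OF R p _ free]
  have i: "DA p R i = Some x" using good[OF z(1)] ij(1) objects_cases by metis
  have j: "DA p R j = Some y" using good[OF z(2)] ij(2) objects_cases by metis
  have "DA p R h = None"
  proof (cases "DA p R h")
    case (Some w)
    then have "w \<noteq> x" "w \<noteq> y" "w \<noteq> z" using DA_inj[OF R p] i j h(1,2) free by blast+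
    then show ?thesis using objects_cases by blast
  qed
  then show "(i, h) \<in> p x \<and> (j, h) \<in> p y"
    using DA_unassigned_envy[OF R p h(3)] DA_unassigned_envy[OF R p h(4)]
      DA_inj[OF R p i] DA_inj[OF R p j] by auto
qed

lemma RDA_waste_lt:
  fixes R :: "('n::finite, 'o::finite) profile"
  assumes R: "R \<in> profiles"
    and agents: "UNIV = {i, j, k, l}" "distinct [i, j, k, l]"
    and objects: "UNIV = {x, y, z}" "x \<noteq> y" "x \<noteq> z" "y \<noteq> z"
    and z: "acceptable (R i) z" "acceptable (R j) z" "\<not> acceptable (R k) z" "\<not> acceptable (R l) z"
    and pref: "(Some x, Some z) \<in> R i" "(Some y, Some z) \<in> R j"
  shows "assign_prob RDA R i None < 1 / 6 \<or> unassigned_prob RDA R z < 1 / 6"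
proof -
  let ?F = "\<lambda>k l A B. {p :: ('n, 'o) priority. (\<forall>h\<in>A. (k, h) \<in> p x) \<and> (\<forall>h\<in>B. (l, h) \<in> p y) \<and>
    (\<forall>h\<in>{i}. (j, h) \<in> p z)}"
  have bound: "assign_prob RDA R i None \<le> measure_pmf.prob uniform_priority E"
    if "\<And>p. p \<in> priorities \<Longrightarrow> DA p R i = None \<Longrightarrow> p \<in> E" for E
    unfolding assign_prob_RDA using that by (intro prob_mono_priority) auto
  note unassigned = DA_unassigned_priorities[OF R _ agents(1) objects(2-4) z pref]
  \<comment> \<open>In the first two cases only one allocation of \<open>x\<close> and
    \<open>y\<close> to \<open>k\<close> and \<open>l\<close> survives, with bound 1/8. The next two
    give overlapping events of probability 1/12 each. The last bounds the probability that
    \<open>z\<close> is free by 1/9 instead.\<close>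
  consider "\<not> (acceptable (R k) x \<and> acceptable (R l) y)" | "\<not> (acceptable (R l) x \<and> acceptable (R k) y)"
    | "acceptable (R i) y" | "(Some x, Some z) \<in> R j"
    | "acceptable (R k) x" "acceptable (R l) x" "acceptable (R k) y" "acceptable (R l) y"
      "\<not> acceptable (R i) y" "(Some x, Some z) \<notin> R j"
    by blast
  then show ?thesis
  proof cases
    case 1
    have "assign_prob RDA R i None \<le> measure_pmf.prob uniform_priority (?F l k {i} {j})"
    proof (rule bound)
      fix p :: "('n, 'o) priority" assume "p \<in> priorities" "DA p R i = None"
      from unassigned[OF this] 1 show "p \<in> ?F l k {i} {j}" by auto
    qed
    also have "\<dots> < 1 / 6" using agents(2) by (subst prob_tops[OF objects]) auto
    finally show ?thesis by simp
  next
    case 2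
    have "assign_prob RDA R i None \<le> measure_pmf.prob uniform_priority (?F k l {i} {j})"
    proof (rule bound)
      fix p :: "('n, 'o) priority" assume "p \<in> priorities" "DA p R i = None"
      from unassigned[OF this] 2 show "p \<in> ?F k l {i} {j}" by auto
    qed
    also have "\<dots> < 1 / 6" using agents(2) by (subst prob_tops[OF objects]) auto
    finally show ?thesis by simp
  next
    case 3
    have "assign_prob RDA R i None \<le>
        measure_pmf.prob uniform_priority (?F k l {i} {i, j} \<union> ?F l k {i} {i, j})"
    proof (rule bound)
      fix p :: "('n, 'o) priority" assume "p \<in> priorities" "DA p R i = None"
      from unassigned[OF this] 3 show "p \<in> ?F k l {i} {i, j} \<union> ?F l k {i} {i, j}" by auto
    qed
    also have "\<dots> < 1 / 6" using agents(2) by (intro prob_union_lt[OF objects agents]) auto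
    finally show ?thesis by simp
  next
    case 4
    have "assign_prob RDA R i None \<le>
        measure_pmf.prob uniform_priority (?F k l {i, j} {j} \<union> ?F l k {i, j} {j})"
    proof (rule bound)
      fix p :: "('n, 'o) priority" assume "p \<in> priorities" "DA p R i = None"
      from unassigned[OF this] 4 show "p \<in> ?F k l {i, j} {j} \<union> ?F l k {i, j} {j}" by auto
    qed
    also have "\<dots> < 1 / 6" using agents(2) by (intro prob_union_lt[OF objects agents]) auto
    finally show ?thesis by simp
  next
    case 5
    have "unassigned_prob RDA R z \<le> measure_pmf.prob uniform_priority
      {p. (\<forall>h\<in>{k, l}. (i, h) \<in> p x) \<and> (\<forall>h\<in>{k, l}. (j, h) \<in> p y) \<and> (\<forall>h\<in>{}. (i, h) \<in> p z)}"
      unfolding unassigned_prob_RDA[OF R]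
      using DA_free_object_priorities[OF R _ objects(1) z(1,2) 5(5,6)] 5(1-4) agents(2)
      by (intro prob_mono_priority) auto
    also have "\<dots> < 1 / 6" using agents(2) by (subst prob_tops[OF objects]) auto
    finally show ?thesis by simp
  qed
qed

text \<open>If both probabilities were at least 1/6, some \<open>p\<close> would leave
  \<open>i\<close> unassigned and some \<open>p'\<close> would leave \<open>z\<close> free. These
  two outcomes yield the agents and objects for \<open>RDA_waste_lt\<close>.\<close>

lemma RDA_waste_lt_sixth:
  fixes R :: "('n::finite, 'o::finite) profile"
  assumes card: "CARD('n) = 4" "CARD('o) = 3"
    and R: "R \<in> profiles" and iz: "acceptable (R i) z"
  shows "min (assign_prob RDA R i None) (unassigned_prob RDA R z) < 1 / 6"
proof (rule ccontr)
  assume *: "\<not> ?thesis"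
  have "measure_pmf.prob uniform_priority {p. DA p R i = None} > 0"
    using * by (simp add: assign_prob_RDA)
  then obtain p where p: "p \<in> priorities" "DA p R i = None"
    by (auto elim: prob_pos_priority)
  have "measure_pmf.prob uniform_priority {p. \<forall>h. DA p R h \<noteq> Some z} > 0"
    using * by (simp add: unassigned_prob_RDA[OF R])
  then obtain p' where p': "p' \<in> priorities" "\<And>h. DA p' R h \<noteq> Some z"
    by (auto elim: prob_pos_priority)
  note good = DA_free_object_preferred[OF R p'(1) _ p'(2)]
  obtain j where j: "j \<noteq> i" "DA p R j = Some z" using DA_unassigned_envy[OF R p(1) iz p(2)] by blast
  then have jz: "acceptable (R j) z" using DA_individually_rational[OF R p(1)] by blast
  obtain x where x: "x \<noteq> z" "DA p' R i = Some x" "(Some x, Some z) \<in> R i" using good[OF iz] by blast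
  obtain y where y: "y \<noteq> z" "DA p' R j = Some y" "(Some y, Some z) \<in> R j" using good[OF jz] by blast
  have xy: "x \<noteq> y" using x y j DA_inj[OF R p'(1)] by blast
  have objects: "UNIV = {x, y, z}"
    using card_subset_eq[of UNIV "{x, y, z}"] card(2) x y xy by auto
  have "card (UNIV - {i, j}) = 2" using card(1) j(1) by (simp add: card_Diff_subset)
  then obtain k l where kl: "UNIV - {i, j} = {k, l}" "k \<noteq> l" by (auto simp: card_2_iff)
  have agents: "UNIV = {i, j, k, l}" "distinct [i, j, k, l]"
    using kl j(1) by (auto 0 3)
  \<comment> \<open>Under \<open>p'\<close> such an agent would need \<open>x\<close> or
    \<open>y\<close>, but these go to \<open>i\<close> and \<open>j\<close>.\<close>
  have "\<not> acceptable (R h) z" if "h \<noteq> i" "h \<noteq> j" for h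
  proof
    assume "acceptable (R h) z"
    then obtain w where w: "w \<noteq> z" "DA p' R h = Some w" using good by blast
    moreover have "w = x \<or> w = y" using objects w(1) by blast
    ultimately show False using x(2) y(2) DA_inj[OF R p'(1)] that by blast
  qed
  then have "\<not> acceptable (R k) z" "\<not> acceptable (R l) z" using agents(2) by auto
  then show False
    using RDA_waste_lt[OF R agents objects xy x(1) y(1) iz jz _ _ x(3) y(3)] * by auto
qed


section \<open>Object waste\<close>

lemma RDA_object_wasteful_quarter:
  assumes card: "CARD('n::finite) = 4" "CARD('o::finite) = 3"
  shows "object_wasteful (1 / 4) (RDA :: ('n, 'o) mechanism)"
proof -
  obtain i j k l :: 'n where agents: "UNIV = {i, j, k, l}" "distinct [i, j, k, l]"
    using card(1) by (auto simp: card_Suc_eq numeral_eq_Suc)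
  obtain x y z :: 'o where objects: "UNIV = {x, y, z}" "x \<noteq> y" "x \<noteq> z" "y \<noteq> z"
    using card(2) by (auto simp: card_3_iff)
  \<comment> \<open>Agent \<open>k\<close> competes only with \<open>i\<close> at \<open>x\<close>,
    and \<open>l\<close> only with \<open>j\<close> at \<open>y\<close>, while \<open>i\<close> and
    \<open>j\<close> share the fallback \<open>z\<close>. Whatever follows \<open>None\<close> is
    unacceptable.\<close>
  define R :: "('n, 'o) profile" where
    "R = (\<lambda>h. if h = i then order4 (Some x) (Some z) None (Some y)
              else if h = j then order4 (Some y) (Some z) None (Some x)
              else if h = k then order4 (Some x) None (Some y) (Some z)
              else order4 (Some y) None (Some x) (Some z))"
  have options: "(UNIV :: 'o option set) = {None, Some x, Some y, Some z}"
    using objects(1) by (auto simp: UNIV_option_conv)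
  have lin: "linear_order (order4 a b c d)" if "{None, Some x, Some y, Some z} = {a, b, c, d}" for a b c d
    using that by (intro linear_order4) (simp only: options)
  have "linear_order (R h)" for h
    unfolding R_def by (simp only: split: if_split) (intro conjI impI lin; blast)
  then have R: "R \<in> profiles" by (simp add: profiles_def)
  have distinct: "j \<noteq> i" "k \<noteq> i" "k \<noteq> j" "l \<noteq> i" "l \<noteq> j" "l \<noteq> k" using agents(2) by auto
  have acc: "acceptable (R i) x" "acceptable (R i) z" "\<not> acceptable (R i) y"
    "acceptable (R j) y" "acceptable (R j) z" "\<not> acceptable (R j) x"
    "acceptable (R k) x" "\<not> acceptable (R k) y" "\<not> acceptable (R k) z"
    "acceptable (R l) y" "\<not> acceptable (R l) x" "\<not> acceptable (R l) z"
    and top: "(Some z, Some x) \<notin> R i" "(Some z, Some y) \<notin> R j"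
    using objects(2-4) distinct by (simp_all add: R_def acceptable_def order4_def Let_def)
  have agents_cases: "h = i \<or> h = j \<or> h = k \<or> h = l" for h using agents(1) by blast
  have objects_cases: "w = x \<or> w = y \<or> w = z" for w using objects(1) by blast
  have acc_k: "acceptable (R k) v \<longleftrightarrow> v = x" and acc_l: "acceptable (R l) v \<longleftrightarrow> v = y" for v
    using acc objects_cases[of v] by auto
  have acc_x: "acceptable (R h) x \<longleftrightarrow> h = k \<or> h = i" and acc_y: "acceptable (R h) y \<longleftrightarrow> h = l \<or> h = j" for h
    using acc agents_cases[of h] by auto

  \<comment> \<open>If \<open>i\<close> beats \<open>k\<close> at \<open>x\<close> and
    \<open>j\<close> beats \<open>l\<close> at \<open>y\<close>, neither falls back on
    \<open>z\<close>; the two independent comparisons have probability 1/4.\<close>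
  have "1 / 4 = measure_pmf.prob uniform_priority
      {p. (\<forall>h\<in>{k}. (i, h) \<in> p x) \<and> (\<forall>h\<in>{l}. (j, h) \<in> p y) \<and> (\<forall>h\<in>{}. (i, h) \<in> p z)}"
    using agents(2) by (subst prob_tops[OF objects]) auto
  also have "\<dots> \<le> unassigned_prob RDA R z"
    unfolding unassigned_prob_RDA[OF R]
  proof (rule prob_mono_priority, safe)
    fix p :: "('n, 'o) priority" and h
    assume p: "p \<in> priorities" and "\<forall>h\<in>{k}. (i, h) \<in> p x" "\<forall>h\<in>{l}. (j, h) \<in> p y"
      and h: "DA p R h = Some z"
    then have q: "(i, k) \<in> p x" "(j, l) \<in> p y" by auto
    have lin: "linear_order (p w)" for w using p by (simp add: priorities_def)
    have "h = i \<or> h = j"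
      using DA_individually_rational[OF R p h] acc agents_cases[of h] by auto
    then show False
    proof
      assume "h = i"
      then obtain g where g: "g \<noteq> i" "DA p R g = Some x" "(g, i) \<in> p x"
        using DA_no_blocking_pair[OF R p acc(1)] h top by auto
      then have "g = k"
        using DA_individually_rational[OF R p g(2)] acc agents_cases[of g] by auto
      then show False using g q linear_order_antisym[OF lin] by blast
    next
      assume "h = j"
      then obtain g where g: "g \<noteq> j" "DA p R g = Some y" "(g, j) \<in> p y"
        using DA_no_blocking_pair[OF R p acc(4)] h top by auto
      then have "g = l"
        using DA_individually_rational[OF R p g(2)] acc agents_cases[of g] by auto
      then show False using g q linear_order_antisym[OF lin] by blast
    qed
  qed
  finally have free: "unassigned_prob RDA R z \<ge> 1 / 4" .

  \<comment> \<open>Agent \<open>a\<close> is left out when \<open>k\<close> beats \<open>i\<close>,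
    \<open>l\<close> beats \<open>j\<close>, and \<open>b\<close> beats \<open>a\<close> at
    \<open>z\<close>: three independent comparisons.\<close>
  have loses: "assign_prob RDA R a None \<ge> 1 / 8" if ab: "a = i \<and> b = j \<or> a = j \<and> b = i" for a b
  proof -
    have "1 / 8 = measure_pmf.prob uniform_priority
      {p. (\<forall>h\<in>{i}. (k, h) \<in> p x) \<and> (\<forall>h\<in>{j}. (l, h) \<in> p y) \<and> (\<forall>h\<in>{a}. (b, h) \<in> p z)}"
      using agents(2) ab by (subst prob_tops[OF objects]) auto
    also have "\<dots> \<le> assign_prob RDA R a None"
      unfolding assign_prob_RDA
    proof (rule prob_mono_priority, rule CollectI)
      fix p :: "('n, 'o) priority"
      assume p: "p \<in> priorities" and "p \<in> {p. (\<forall>h\<in>{i}. (k, h) \<in> p x) \<and> (\<forall>h\<in>{j}. (l, h) \<in> p y) \<and>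
        (\<forall>h\<in>{a}. (b, h) \<in> p z)}"
      then have q: "(k, i) \<in> p x" "(l, j) \<in> p y" "(b, a) \<in> p z" by auto
      have lin: "linear_order (p w)" for w using p by (simp add: priorities_def)
      note rational = DA_individually_rational[OF R p]
      have outsider: "DA p R h = Some w"
        if "acceptable (R h) w" "\<And>v. acceptable (R h) v \<Longrightarrow> v = w" "(h, g) \<in> p w"
          "\<And>f. acceptable (R f) w \<Longrightarrow> f = h \<or> f = g" for h g w
      proof (rule ccontr)
        assume "DA p R h \<noteq> Some w"
        then have "DA p R h = None" using rational[of h] that(2) by (cases "DA p R h") auto
        from DA_unassigned_envy[OF R p that(1) this]
        obtain f where f: "f \<noteq> h" "DA p R f = Some w" "(f, h) \<in> p w" by blast
        then have "f = g" using rational[OF f(2)] that(4) by blast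
        then show False using f that(3) linear_order_antisym[OF lin] by blast
      qed
      have "DA p R k = Some x"
        using acc_k acc_x q(1) by (intro outsider[of k x i]) auto
      moreover have "DA p R l = Some y"
        using acc_l acc_y q(2) by (intro outsider[of l y j]) auto
      ultimately have no: "DA p R a \<noteq> Some x" "DA p R a \<noteq> Some y" "DA p R b \<noteq> Some x" "DA p R b \<noteq> Some y"
        using DA_inj[OF R p] ab agents(2) by auto
      show "DA p R a = None"
      proof (rule ccontr)
        assume "DA p R a \<noteq> None"
        then obtain w where "DA p R a = Some w" by blast
        then have a: "DA p R a = Some z" using no objects_cases[of w] by auto
        \<comment> \<open>With \<open>z\<close> taken by \<open>a\<close>, nothing is left for
          \<open>b\<close>, who would then block at \<open>z\<close>.\<close>
        have "a \<noteq> b" using ab agents(2) by auto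
        then have "DA p R b \<noteq> Some w" for w
          using no objects_cases[of w] DA_inj[OF R p a, of b] by auto
        then have "DA p R b = None" by (cases "DA p R b") auto
        moreover have "acceptable (R b) z" using ab acc by auto
        ultimately obtain g where "g \<noteq> b" "DA p R g = Some z" "(g, b) \<in> p z"
          using DA_unassigned_envy[OF R p] by blast
        then show False using a q(3) DA_inj[OF R p] linear_order_antisym[OF lin] by blast
      qed
    qed
    finally show ?thesis .
  qed
  have "{h. acceptable (R h) z} = {i, j}" using acc agents_cases by blast
  then have "(\<Sum>h | acceptable (R h) z. assign_prob RDA R h None) \<ge> 1 / 4"
    using loses[of i j] loses[of j i] agents(2) by simp
  then show ?thesis using R free unfolding object_wasteful_def by force
qed


section \<open>The extremal waste levels\<close>

lemma unassigned_prob_RDA_bounds: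
  fixes R :: "('n::finite, 'o::finite) profile"
  assumes "R \<in> profiles"
  shows "0 \<le> unassigned_prob RDA R x" "unassigned_prob RDA R x \<le> 1"
  by (simp_all add: unassigned_prob_RDA[OF assms])

text \<open>Among finitely many instances the largest waste level is attained, and it is the
  extremal one. \<open>g\<close> measures the waste of an instance, and \<open>W q\<close> stands
  for \<open>q\<close>-wastefulness.\<close>

lemma exists_max_level:
  fixes g :: "'a::finite \<Rightarrow> real"
  assumes "P a" and range: "\<And>b. P b \<Longrightarrow> g b \<in> {0..1}"
    and W: "\<And>q. W q \<longleftrightarrow> (\<exists>b. P b \<and> q \<le> g b)"
  shows "\<exists>b. P b \<and> g b \<in> {0..1} \<and> W (g b) \<and> (\<forall>q'\<in>{g b<..1}. \<not> W q')"
proof -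
  have "Max (g ` Collect P) \<in> g ` Collect P" using \<open>P a\<close> by (intro Max_in) auto
  then obtain b where b: "P b" "Max (g ` Collect P) = g b" by auto
  have "g c \<le> g b" if "P c" for c
    unfolding b(2)[symmetric] using that by (intro Max_ge) auto
  then have "\<forall>q'\<in>{g b<..1}. \<not> W q'" using W by fastforce
  then show ?thesis using b(1) range W by blast
qed

theorem lemma3:
  assumes "CARD('n::finite) = 4" and "CARD('o::finite) = 3"
  shows "(\<exists>q<1/6. at_most_agent_object_wasteful q (RDA :: ('n, 'o) mechanism)) \<and>
         (\<exists>q\<ge>1/4. at_most_object_wasteful q (RDA :: ('n, 'o) mechanism))"
proof
  let ?f = "RDA :: ('n, 'o) mechanism"
  have waste: "object_wasteful (1 / 4) ?f" using RDA_object_wasteful_quarter[OF assms] .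
  then obtain R :: "('n, 'o) profile" and x where R: "R \<in> profiles"
    and s: "(\<Sum>i | acceptable (R i) x. assign_prob RDA R i None) \<ge> 1 / 4"
    unfolding object_wasteful_def by auto
  \<comment> \<open>A sum that is at least 1/4 is not empty, which supplies an instance for the
    maximum of agent-object waste.\<close>
  have "{i. acceptable (R i) x} \<noteq> {}" using s by (intro notI) simp
  then obtain i where i: "acceptable (R i) x" by blast

  define g where "g = (\<lambda>(R, x, i). min (assign_prob ?f R i None) (unassigned_prob ?f R x))"
  define P where "P = (\<lambda>(R :: ('n, 'o) profile, x, i). R \<in> profiles \<and> acceptable (R i) x)"
  have "\<exists>b. P b \<and> g b \<in> {0..1} \<and> agent_object_wasteful (g b) ?f \<and>
      (\<forall>q'\<in>{g b<..1}. \<not> agent_object_wasteful q' ?f)"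
  proof (rule exists_max_level)
    show "P (R, x, i)" using R i by (simp add: P_def)
    show "g b \<in> {0..1}" if "P b" for b
      using that by (auto simp: unassigned_prob_RDA_bounds P_def g_def assign_prob_def min_le_iff_disj)
    show "agent_object_wasteful q ?f \<longleftrightarrow> (\<exists>b. P b \<and> q \<le> g b)" for q
      unfolding agent_object_wasteful_def P_def g_def split_paired_Ex prod.case by blast
  qed
  moreover have "g b < 1 / 6" if "P b" for b
    using that RDA_waste_lt_sixth[OF assms] by (cases b) (simp add: P_def g_def)
  ultimately show "\<exists>q<1/6. at_most_agent_object_wasteful q ?f"
    unfolding at_most_agent_object_wasteful_def by blast

  define h where "h = (\<lambda>(R, x).
    min (\<Sum>i | acceptable (R i) x. assign_prob ?f R i None) (unassigned_prob ?f R x))"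
  define Q where "Q = (\<lambda>(R :: ('n, 'o) profile, x :: 'o). R \<in> profiles)"
  have "\<exists>b. Q b \<and> h b \<in> {0..1} \<and> object_wasteful (h b) ?f \<and>
      (\<forall>q'\<in>{h b<..1}. \<not> object_wasteful q' ?f)"
  proof (rule exists_max_level)
    show "Q (R, x)" using R by (simp add: Q_def)
    show "h b \<in> {0..1}" if "Q b" for b
      using that by (auto simp: unassigned_prob_RDA_bounds Q_def h_def assign_prob_def min_le_iff_disj sum_nonneg)
    show "object_wasteful q ?f \<longleftrightarrow> (\<exists>b. Q b \<and> q \<le> h b)" for q
      unfolding object_wasteful_def Q_def h_def split_paired_Ex prod.case by blast
  qed
  then obtain q where q: "q \<in> {0..1}" "object_wasteful q ?f" "\<forall>q'\<in>{q<..1}. \<not> object_wasteful q' ?f"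
    by blast
  then have "q \<ge> 1 / 4" using waste by (force simp: not_le)
  then show "\<exists>q\<ge>1/4. at_most_object_wasteful q ?f"
    using q unfolding at_most_object_wasteful_def by blast
qed

end
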